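(* Let $\alpha\in(0,1)$, let $B$ be a real $n\times n$ matrix and $d\in\mathbb{R}^n$. Then any solution $c:\mathbb{R}\to\mathbb{R}^n$ of the inhomogeneous linear differential equation $\dot c(t)=Bc(t)+d$ is a soliton of the mapping $M_\alpha$. These solitons are orbits of a one-parameter subgroup of the affine group $\mathrm{Aff}(n)$ acting on $\mathbb{R}^n$, i.e. they are of the form $$c(t)=v+F_B(t)(Bv+d)=\exp(Bt)v+F_B(t)d,\qquad v=c(0).$$
   Context: $\mathrm{Aff}(n)$ is the group of affine maps $(A,b):x\mapsto Ax+b$ of $\mathbb{R}^n$ with $A\in\mathrm{GL}(n,\mathbb{R})$ and $b\in\mathbb{R}^n$. For $\alpha\in(0,1)$, a smooth curve $c:\mathbb{R}\to\mathbb{R}^n$ is called a soliton of the mapping $M_\alpha$ if there are $\epsilon>0$ and a smooth map $s\in(-\epsilon,\epsilon)\mapsto(A(s),b(s))\in\mathrm{Aff}(n)$ such that $(1-\alpha)c(t)+\alpha c(t+s)=A(s)c(t)+b(s)$ for all $s\in(-\epsilon,\epsilon)$ and $t\in\mathbb{R}$. For a real $n\times n$ matrix $B$ and $t\in\mathbb{R}$, $F_B(t)=\sum_{k=1}^\infty\frac{t^k}{k!}B^{k-1}$. The one-parameter subgroup in question is $t\mapsto(\exp(Bt),F_B(t)d)\in\mathrm{Aff}(n)$, which corresponds to $\exp\left(t\begin{pmatrix}B&d\\0&0\end{pmatrix}\right)$ under the embedding $(A,b)\mapsto\begin{pmatrix}A&b\\0&1\end{pmatrix}$ of $\mathrm{Aff}(n)$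 into $\mathrm{GL}(n+1,\mathbb{R})$. *)

theory Defs
  imports "HOL-Analysis.Analysis" "HOL-Algebra.Group_Action"
begin

text \<open>Matrix powers with respect to the matrix product \<open>**\<close>. The overloaded \<open>^\<close> and \<open>exp\<close>
  cannot be used here: multiplication on \<open>real^'n^'n\<close> is componentwise.\<close>

primrec mat_pow :: "real^'n^'n \<Rightarrow> nat \<Rightarrow> real^'n^'n" where
  "mat_pow B 0 = mat 1"
| "mat_pow B (Suc k) = B ** mat_pow B k"

definition mat_exp :: "real^'n^'n \<Rightarrow> real^'n^'n" where
  "mat_exp B = (\<Sum>k. (1 / fact k) *\<^sub>R mat_pow B k)"

text \<open>\<open>F\<^sub>B(t) = \<Sum>\<^sub>k\<^sub>\<ge>\<^sub>1 t\<^sup>k/k! B\<^sup>k\<^sup>-\<^sup>1\<close>, with the summation index shifted to start at 0.\<close>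

definition F_mat :: "real^'n^'n \<Rightarrow> real \<Rightarrow> real^'n^'n" where
  "F_mat B t = (\<Sum>k. (t ^ Suc k / fact (Suc k)) *\<^sub>R mat_pow B k)"

text \<open>All iterated derivatives exist at every point of \<open>S\<close>. The derivatives are two-sided, so
  this is the usual notion of smoothness for open \<open>S\<close>, which is the only case used.\<close>

definition smooth_curve_on :: "real set \<Rightarrow> (real \<Rightarrow> 'v::real_normed_vector) \<Rightarrow> bool" where
  "smooth_curve_on S f \<longleftrightarrow>
    (\<forall>k. \<forall>t\<in>S. ((\<lambda>g x. vector_derivative g (at x)) ^^ k) f differentiable (at t))"

text \<open>The affine group of \<open>real^'n\<close>; the multiplication is composition of the maps
  \<open>x \<mapsto> A x + b\<close>. Its carrier is open in \<open>real^'n^'n \<times> real^'n\<close>, so smoothness of a map into the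
  group is smoothness as a map into this vector space.\<close>

definition aff_group :: "((real^'n^'n) \<times> (real^'n)) monoid" where
  "aff_group =
    \<lparr>carrier = {(A, b). invertible A},
     mult = (\<lambda>(A, b) (A', b'). (A ** A', A *v b' + b)),
     one = (mat 1, 0)\<rparr>"

definition aff_act :: "(real^'n^'n) \<times> (real^'n) \<Rightarrow> real^'n \<Rightarrow> real^'n" where
  "aff_act g x = fst g *v x + snd g"

lemma group_aff_group: "group (aff_group :: ((real^'n^'n) \<times> (real^'n)) monoid)"
proof (rule groupI)
  fix g :: "(real^'n^'n) \<times> (real^'n)"
  assume g: "g \<in> carrier aff_group"
  obtain A b where gA: "g = (A, b)" by (cases g)
  with g obtain A' where A': "A' ** A = mat 1" "A ** A' = mat 1"
    by (auto simp: aff_group_def invertible_def)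
  have "(A', - (A' *v b)) \<in> carrier aff_group"
    using A' by (auto simp: aff_group_def invertible_def)
  moreover have "(A', - (A' *v b)) \<otimes>\<^bsub>aff_group\<^esub> g = \<one>\<^bsub>aff_group\<^esub>"
    using A' gA by (simp add: aff_group_def)
  ultimately show "\<exists>h\<in>carrier aff_group. h \<otimes>\<^bsub>aff_group\<^esub> g = \<one>\<^bsub>aff_group\<^esub>"
    by blast
next
  show "\<one>\<^bsub>aff_group\<^esub> \<in> carrier (aff_group :: ((real^'n^'n) \<times> (real^'n)) monoid)"
    by (auto simp: aff_group_def invertible_def intro!: exI[of _ "mat 1"])
qed (auto simp: aff_group_def matrix_mul_assoc matrix_vector_mul_assoc
       matrix_vector_right_distrib intro: invertible_mult)

lemma group_action_aff: "group_action (aff_group :: ((real^'n^'n) \<times> (real^'n)) monoid) UNIV aff_act"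
proof -
  have bij: "aff_act g \<in> Bij UNIV" if g: "g \<in> carrier aff_group"
    for g :: "(real^'n^'n) \<times> (real^'n)"
  proof -
    obtain A b where gA: "g = (A, b)" by (cases g)
    with g obtain A' where A': "A' ** A = mat 1" "A ** A' = mat 1"
      by (auto simp: aff_group_def invertible_def)
    have "bij (aff_act g)"
      by (rule o_bij[of "\<lambda>y. A' *v (y - b)"])
        (auto simp: fun_eq_iff gA aff_act_def matrix_vector_mul_assoc A')
    then show ?thesis by (simp add: Bij_def)
  qed
  have "aff_act (g \<otimes>\<^bsub>aff_group\<^esub> h) = compose UNIV (aff_act g) (aff_act h)"
    for g h :: "(real^'n^'n) \<times> (real^'n)"
    by (cases g; cases h) (simp add: aff_group_def aff_act_def compose_def fun_eq_iff
        matrix_vector_mul_assoc matrix_vector_right_distrib)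
  with bij have "aff_act \<in> hom (aff_group :: ((real^'n^'n) \<times> (real^'n)) monoid) (BijGroup UNIV)"
    unfolding hom_def by (simp add: BijGroup_def Pi_iff)
  then show ?thesis
    by (intro group_action.intro group_hom.intro group_hom_axioms.intro
        group_aff_group group_BijGroup)
qed

definition real_add_group :: "real monoid" where
  "real_add_group = \<lparr>carrier = UNIV, mult = (+), one = 0\<rparr>"

definition one_parameter_subgroup :: "(real \<Rightarrow> (real^'n^'n) \<times> (real^'n)) \<Rightarrow> bool" where
  "one_parameter_subgroup \<phi> \<longleftrightarrow> \<phi> \<in> hom real_add_group aff_group \<and> smooth_curve_on UNIV \<phi>"

text \<open>A curve is a soliton of the map \<open>M\<^sub>\<alpha>\<close> if its images
  \<open>t \<mapsto> (1 - \<alpha>) c(t) + \<alpha> c(t + s)\<close> are, for small \<open>s\<close>, smoothly varying affine images of it.\<close>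

definition soliton :: "real \<Rightarrow> (real \<Rightarrow> real^'n) \<Rightarrow> bool" where
  "soliton \<alpha> c \<longleftrightarrow>
    smooth_curve_on UNIV c \<and>
    (\<exists>\<epsilon>>0. \<exists>\<sigma>. \<sigma> ` {-\<epsilon><..<\<epsilon>} \<subseteq> carrier aff_group \<and>
       smooth_curve_on {-\<epsilon><..<\<epsilon>} \<sigma> \<and>
       (\<forall>s\<in>{-\<epsilon><..<\<epsilon>}. \<forall>t. (1 - \<alpha>) *\<^sub>R c t + \<alpha> *\<^sub>R c (t + s) = aff_act (\<sigma> s) (c t)))"

end

theory Submission
  imports Defs
begin

text \<open>Differentiating the defining power series gives \<open>(exp(tB))' = B exp(tB)\<close> and
  \<open>F\<^sub>B' = exp(tB)\<close>, and comparing coefficients gives \<open>B F\<^sub>B(t) = F\<^sub>B(t) B = exp(tB) - 1\<close>. Since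
  \<open>exp(-tB) x(t)\<close> is constant for every solution of \<open>x' = Bx\<close>, a solution \<open>c\<close> of \<open>c' = Bc + d\<close>
  satisfies \<open>c(t) = exp(tB) c(0) + F\<^sub>B(t) d\<close>. Applied to translates of \<open>c\<close>, this gives the
  group law and \<open>(1 - \<alpha>) c(t) + \<alpha> c(t + s) = ((1 - \<alpha>) 1 + \<alpha> exp(sB)) c(t) + \<alpha> F\<^sub>B(s) d\<close>, where the
  linear part is invertible for small \<open>s\<close> by continuity of the determinant. All curves involved
  solve equations \<open>f' = L f + w\<close> with \<open>L\<close> linear; then \<open>f'\<close> solves \<open>g' = L g\<close>, so they are smooth.\<close>

section \<open>Curves solving linear differential equations\<close>

text \<open>Each coordinate with respect to \<open>Basis\<close> is a real power series that
  converges everywhere, so the scalar theorem on termwise differentiation applies.\<close>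

lemma has_vector_derivative_power_series:
  fixes a :: "nat \<Rightarrow> 'a::euclidean_space" and f f' :: "real \<Rightarrow> 'a"
  assumes f: "\<And>t. (\<lambda>k. t ^ k *\<^sub>R a k) sums f t"
    and f': "\<And>t. (\<lambda>k. t ^ k *\<^sub>R (real (Suc k) *\<^sub>R a (Suc k))) sums f' t"
  shows "(f has_vector_derivative f' t) (at t)"
  unfolding has_vector_derivative_def
proof (subst has_derivative_componentwise_within, intro ballI)
  fix b :: 'a
  assume "b \<in> Basis"
  have s: "(\<lambda>k. (a k \<bullet> b) * y ^ k) sums (f y \<bullet> b)" for y
    using bounded_linear.sums[OF bounded_linear_inner_left f] by (simp add: mult.commute)
  have s': "(\<lambda>k. diffs (\<lambda>k. a k \<bullet> b) k * y ^ k) sums (f' y \<bullet> b)" for y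
    using bounded_linear.sums[OF bounded_linear_inner_left f'] by (simp add: diffs_def mult_ac)
  have "((\<lambda>x. \<Sum>k. (a k \<bullet> b) * x ^ k) has_field_derivative
      (\<Sum>k. diffs (\<lambda>k. a k \<bullet> b) k * t ^ k)) (at t)"
    by (rule termdiffs_strong_converges_everywhere) (rule sums_summable[OF s])
  then have "((\<lambda>x. f x \<bullet> b) has_field_derivative f' t \<bullet> b) (at t)"
    by (simp add: sums_unique[OF s, symmetric] sums_unique[OF s', symmetric])
  then show "((\<lambda>x. f x \<bullet> b) has_derivative (\<lambda>x. x *\<^sub>R f' t \<bullet> b)) (at t)"
    by (simp add: has_field_derivative_def mult_commute_abs)
qed

lemma smooth_curve_on_linear_ode:
  fixes f :: "real \<Rightarrow> 'v::real_normed_vector"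
  assumes L: "bounded_linear L"
    and f: "\<And>t. (f has_vector_derivative L (f t) + w) (at t)"
  shows "smooth_curve_on S f"
proof -
  have "((\<lambda>g x. vector_derivative g (at x)) ^^ k) f differentiable (at t)" for k t
    using f
  \<comment> \<open>Passing from \<open>f\<close> to its derivative changes the inhomogeneity from
    \<open>w\<close> to 0, so both are generalized.\<close>
  proof (induction k arbitrary: f w)
    case 0
    then show ?case by (auto intro: differentiableI_vector)
  next
    case (Suc k)
    interpret bounded_linear L by (rule L)
    define g where "g = (\<lambda>t. L (f t) + w)"
    have "(\<lambda>x. vector_derivative f (at x)) = g"
      using Suc.prems by (simp add: g_def fun_eq_iff vector_derivative_at)
    moreover have "(g has_vector_derivative L (g t) + 0) (at t)" for t
      unfolding g_def
      by (auto intro!: derivative_eq_intros has_vector_derivative[OF Suc.prems])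
    ultimately show ?case
      using Suc.IH[of g 0] by (simp add: funpow_Suc_right del: funpow.simps(2))
  qed
  then show ?thesis by (simp add: smooth_curve_on_def)
qed

section \<open>Matrix powers and the exponential series\<close>

lemma matrix_add_rdistrib:
  fixes A :: "'a::semiring_1^'n^'m"
  shows "(A + B) ** C = A ** C + B ** C"
  by (vector matrix_matrix_mult_def sum.distrib[symmetric] distrib_right)

lemma bounded_bilinear_matrix_matrix_mult:
  "bounded_bilinear ((**) :: real^'n^'m \<Rightarrow> real^'p^'n \<Rightarrow> real^'p^'m)"
  by (simp add: bilinear_conv_bounded_bilinear[symmetric] bilinear_def linear_iff
      matrix_add_ldistrib matrix_add_rdistrib matrix_scalar_ac scalar_matrix_assoc)

lemma bounded_bilinear_matrix_vector_mult:
  "bounded_bilinear ((*v) :: real^'n^'m \<Rightarrow> real^'n \<Rightarrow> real^'m)"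
  by (simp add: bilinear_conv_bounded_bilinear[symmetric] bilinear_def linear_iff
      matrix_vector_right_distrib matrix_vector_mult_add_rdistrib
      matrix_vector_mult_scaleR scaleR_matrix_vector_assoc)

lemmas has_vector_derivative_matrix_vector_mult =
  bounded_bilinear.has_vector_derivative[OF bounded_bilinear_matrix_vector_mult]

lemma mat_pow_Suc_right: "mat_pow B (Suc k) = mat_pow B k ** B"
  by (induction k) (auto simp: matrix_mul_assoc)

lemma mat_pow_scaleR: "mat_pow (t *\<^sub>R B) k = t ^ k *\<^sub>R mat_pow B k"
  by (induction k) (auto simp: matrix_scalar_ac scalar_matrix_assoc[symmetric] mult.commute)

lemma norm_mat_pow_le:
  fixes B :: "real^'n^'n"
  obtains K :: real where "0 < K" and "\<And>k. norm (mat_pow B k) \<le> norm (mat 1 :: real^'n^'n) * K ^ k"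
proof -
  obtain C where C: "C > 0" "\<And>(A :: real^'n^'n) (A' :: real^'n^'n). norm (A ** A') \<le> norm A * norm A' * C"
    using bounded_bilinear.pos_bounded[OF bounded_bilinear_matrix_matrix_mult] by blast
  \<comment> \<open>\<open>C\<close> is the bound of \<open>**\<close> as a bilinear map. Adding 1
    keeps \<open>K\<close> positive even for \<open>B = 0\<close>.\<close>
  define K where "K = norm B * C + 1"
  have "norm (mat_pow B k) \<le> norm (mat 1 :: real^'n^'n) * K ^ k" for k
  proof (induction k)
    case (Suc k)
    have "norm (mat_pow B (Suc k)) \<le> (norm B * C) * norm (mat_pow B k)"
      using C(2)[of B "mat_pow B k"] by (simp add: mult_ac)
    also have "\<dots> \<le> K * (norm (mat 1 :: real^'n^'n) * K ^ k)"
      using C(1) Suc.IH by (intro mult_mono) (auto simp: K_def)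
    finally show ?case by (simp add: mult_ac)
  qed simp
  moreover have "0 < K" using C(1) by (simp add: K_def add_nonneg_pos)
  ultimately show ?thesis using that by blast
qed

text \<open>One criterion for both series, \<open>mat_exp\<close> and \<open>F_mat\<close>: the
  terms are dominated by a multiple of the real exponential series at \<open>M * K\<close>, where
  \<open>K\<close> bounds the growth of the powers of \<open>B\<close>.\<close>

lemma summable_mat_pow:
  fixes B :: "real^'n^'n"
  assumes "\<And>k. \<bar>r k\<bar> \<le> C * M ^ k / fact k"
  shows "summable (\<lambda>k. r k *\<^sub>R mat_pow B k)"
proof -
  obtain K where K: "0 < K" "\<And>k. norm (mat_pow B k) \<le> norm (mat 1 :: real^'n^'n) * K ^ k"
    using norm_mat_pow_le[of B] by blast
  show ?thesis
  proof (rule summable_comparison_test')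
    show "summable (\<lambda>k. C * norm (mat 1 :: real^'n^'n) * (inverse (fact k) * (M * K) ^ k))"
      by (intro summable_mult summable_exp)
    show "norm (r k *\<^sub>R mat_pow B k) \<le> C * norm (mat 1 :: real^'n^'n) * (inverse (fact k) * (M * K) ^ k)"
      for k
    proof -
      have "norm (r k *\<^sub>R mat_pow B k) \<le> (C * M ^ k / fact k) * (norm (mat 1 :: real^'n^'n) * K ^ k)"
        using mult_mono[OF assms K(2)] order_trans[OF abs_ge_zero assms] by simp
      then show ?thesis by (simp add: field_simps power_mult_distrib)
    qed
  qed
qed

lemma mat_exp_sums: "(\<lambda>k. t ^ k *\<^sub>R ((1 / fact k) *\<^sub>R mat_pow B k)) sums mat_exp (t *\<^sub>R B)"
proof -
  have "summable (\<lambda>k. (t ^ k / fact k) *\<^sub>R mat_pow B k)"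
    by (rule summable_mat_pow[of _ 1 "\<bar>t\<bar>"]) (simp add: power_abs)
  then show ?thesis
    by (simp add: mat_exp_def mat_pow_scaleR summable_sums)
qed

lemma F_mat_sums: "(\<lambda>k. (t ^ Suc k / fact (Suc k)) *\<^sub>R mat_pow B k) sums F_mat B t"
  unfolding F_mat_def
proof (rule summable_sums, rule summable_mat_pow[of _ "\<bar>t\<bar>" "\<bar>t\<bar>"])
  show "\<bar>t ^ Suc k / fact (Suc k)\<bar> \<le> \<bar>t\<bar> * \<bar>t\<bar> ^ k / fact k" for k
    by (simp add: power_abs abs_mult del: fact_Suc)
       (intro divide_left_mono mult_nonneg_nonneg fact_mono; simp)
qed

lemma mat_exp_zero [simp]: "mat_exp (0 :: real^'n^'n) = mat 1"
proof -
  \<comment> \<open>Only the term with index 0 survives, because \<open>0 ^ 0 = 1\<close>.\<close>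
  have "(\<lambda>k. 0 ^ k *\<^sub>R ((1 / fact k) *\<^sub>R mat_pow (0 :: real^'n^'n) k)) sums mat 1"
    using sums_single[of 0 "\<lambda>_. mat 1 :: real^'n^'n"]
    by (rule back_subst[of "\<lambda>f. f sums _"]) (auto simp: fun_eq_iff)
  from sums_unique2[OF mat_exp_sums[of 0 0] this] show ?thesis by simp
qed

lemma F_mat_zero [simp]: "F_mat B 0 = 0"
  by (simp add: F_mat_def)

text \<open>Multiplication by \<open>B\<close> turns the series of \<open>F_mat\<close> into the
  exponential series without its constant term, hence the index shift by
  \<open>sums_Suc_iff\<close>.\<close>

lemma matrix_mult_F_mat: "B ** F_mat B t = mat_exp (t *\<^sub>R B) - mat 1"
proof -
  have "(\<lambda>k. B ** ((t ^ Suc k / fact (Suc k)) *\<^sub>R mat_pow B k)) sums (B ** F_mat B t)"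
    by (rule bounded_linear.sums[OF bounded_bilinear.bounded_linear_right
          [OF bounded_bilinear_matrix_matrix_mult] F_mat_sums])
  then show ?thesis
    using sums_Suc_iff[of "\<lambda>k. t ^ k *\<^sub>R ((1 / fact k) *\<^sub>R mat_pow B k)" "mat_exp (t *\<^sub>R B) - mat 1"]
      mat_exp_sums[of t B]
    by (auto simp: matrix_scalar_ac scalar_matrix_assoc[symmetric] dest: sums_unique2)
qed

lemma F_mat_mult_matrix: "F_mat B t ** B = mat_exp (t *\<^sub>R B) - mat 1"
proof -
  have "(\<lambda>k. ((t ^ Suc k / fact (Suc k)) *\<^sub>R mat_pow B k) ** B) sums (F_mat B t ** B)"
    by (rule bounded_linear.sums[OF bounded_bilinear.bounded_linear_left
          [OF bounded_bilinear_matrix_matrix_mult] F_mat_sums])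
  then show ?thesis
    using sums_Suc_iff[of "\<lambda>k. t ^ k *\<^sub>R ((1 / fact k) *\<^sub>R mat_pow B k)" "mat_exp (t *\<^sub>R B) - mat 1"]
      mat_exp_sums[of t B]
    by (auto simp: scalar_matrix_assoc[symmetric] mat_pow_Suc_right
        simp del: mat_pow.simps(2) dest: sums_unique2)
qed

text \<open>With E for the exponential and F for \<open>F_mat B t\<close>, both E = 1 + BF and E = 1
  + FB hold, so EB = B + BFB = BE.\<close>

lemma mat_exp_commute: "mat_exp (t *\<^sub>R B) ** B = B ** mat_exp (t *\<^sub>R B)"
proof -
  have e: "mat_exp (t *\<^sub>R B) = mat 1 + B ** F_mat B t" "mat_exp (t *\<^sub>R B) = mat 1 + F_mat B t ** B"
    by (simp_all add: matrix_mult_F_mat F_mat_mult_matrix)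
  have "mat_exp (t *\<^sub>R B) ** B = B + B ** (F_mat B t ** B)"
    by (simp add: e(1) matrix_add_rdistrib matrix_mul_assoc)
  also have "\<dots> = B ** mat_exp (t *\<^sub>R B)"
    by (simp add: e(2) matrix_add_ldistrib)
  finally show ?thesis .
qed

lemma F_mat_has_vector_derivative:
  "(F_mat B has_vector_derivative mat_exp (t *\<^sub>R B)) (at t)"
proof (rule has_vector_derivative_power_series)
  \<comment> \<open>The coefficient 0 at index 0 makes \<open>F_mat\<close> a genuine power series
    in t; differentiation cancels one factor of the factorial and leaves the exponential
    series.\<close>
  let ?a = "\<lambda>k. case k of 0 \<Rightarrow> 0 | Suc j \<Rightarrow> (1 / fact (Suc j)) *\<^sub>R mat_pow B j"
  show "(\<lambda>k. s ^ k *\<^sub>R ?a k) sums F_mat B s" for s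
    using F_mat_sums[of s B] sums_Suc_iff[of "\<lambda>k. s ^ k *\<^sub>R ?a k" "F_mat B s"] by simp
  show "(\<lambda>k. s ^ k *\<^sub>R (real (Suc k) *\<^sub>R ?a (Suc k))) sums mat_exp (s *\<^sub>R B)" for s
    using mat_exp_sums[of s B] by simp
qed

text \<open>No second termwise differentiation: the exponential is 1 + BF, and F has the exponential
  as derivative.\<close>

lemma mat_exp_has_vector_derivative:
  "((\<lambda>t. mat_exp (t *\<^sub>R B)) has_vector_derivative B ** mat_exp (t *\<^sub>R B)) (at t)"
proof -
  have "((\<lambda>t. mat 1 + B ** F_mat B t) has_vector_derivative B ** mat_exp (t *\<^sub>R B)) (at t)"
    by (auto intro!: derivative_eq_intros bounded_linear.has_vector_derivative
          [OF bounded_bilinear.bounded_linear_right[OF bounded_bilinear_matrix_matrix_mult]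
            F_mat_has_vector_derivative])
  then show ?thesis by (simp add: matrix_mult_F_mat)
qed

section \<open>The affine flow\<close>

text \<open>By the product rule the derivative of the left-hand side is EBx - BEx with E = exp(-tB),
  which vanishes since E and B commute. This is the source of all uniqueness statements
  below.\<close>

lemma mat_exp_minus_mult_ode:
  fixes x :: "real \<Rightarrow> real^'n"
  assumes x: "\<And>t. (x has_vector_derivative B *v x t) (at t)"
  shows "mat_exp (- t *\<^sub>R B) *v x t = x 0"
proof -
  let ?y = "\<lambda>t. mat_exp (- t *\<^sub>R B) *v x t"
  have E: "((\<lambda>t. mat_exp (- t *\<^sub>R B)) has_vector_derivative - (B ** mat_exp (- t *\<^sub>R B))) (at t)" for t
  proof -
    have "(((\<lambda>u. mat_exp (u *\<^sub>R B)) \<circ> uminus) has_vector_derivative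
        (-1) *\<^sub>R (B ** mat_exp (- t *\<^sub>R B))) (at t)"
      by (rule vector_diff_chain_at[OF _ mat_exp_has_vector_derivative])
        (auto intro!: derivative_eq_intros)
    then show ?thesis by (simp add: o_def)
  qed
  have "(?y has_vector_derivative 0) (at t)" for t
  proof -
    have "mat_exp (- t *\<^sub>R B) *v (B *v x t) = (B ** mat_exp (- t *\<^sub>R B)) *v x t"
      by (simp only: matrix_vector_mul_assoc mat_exp_commute)
    then show ?thesis
      using has_vector_derivative_matrix_vector_mult[OF E x, of t]
      by (simp add: bounded_bilinear.minus_left[OF bounded_bilinear_matrix_vector_mult])
  qed
  then have "?y t = ?y 0"
    by (intro has_derivative_zero_unique[OF convex_UNIV]) (auto simp: has_vector_derivative_def)
  then show ?thesis by simp
qed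

text \<open>The constancy above, applied to the solution exp(tB)v with initial value v, for every
  v.\<close>

lemma mat_exp_minus_mult: "mat_exp (- t *\<^sub>R B) ** mat_exp (t *\<^sub>R B) = mat 1"
proof -
  have "mat_exp (- t *\<^sub>R B) *v (mat_exp (t *\<^sub>R B) *v v) = v" for v
    using mat_exp_minus_mult_ode[of "\<lambda>t. mat_exp (t *\<^sub>R B) *v v" B t]
      has_vector_derivative_matrix_vector_mult
        [OF mat_exp_has_vector_derivative has_vector_derivative_const[of v]]
    by (simp add: matrix_vector_mul_assoc)
  then show ?thesis by (simp add: matrix_eq matrix_vector_mul_assoc)
qed

lemma invertible_mat_exp: "invertible (mat_exp (t *\<^sub>R B))"
  using mat_exp_minus_mult[of t B] mat_exp_minus_mult[of "- t" B]
  by (auto simp: invertible_def)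

lemma F_mat_mult_vec_has_vector_derivative:
  "((\<lambda>t. F_mat B t *v d) has_vector_derivative B *v (F_mat B t *v d) + d) (at t)"
proof -
  have "B *v (F_mat B t *v d) + d = mat_exp (t *\<^sub>R B) *v d"
    by (simp add: matrix_vector_mul_assoc matrix_mult_F_mat matrix_vector_mult_diff_rdistrib)
  then show ?thesis
    using has_vector_derivative_matrix_vector_mult
        [OF F_mat_has_vector_derivative has_vector_derivative_const[of d], of B t]
    by simp
qed

text \<open>Subtracting the particular solution \<open>F_mat B t *v d\<close>, which vanishes at 0,
  leaves a solution of the homogeneous equation with the same initial value.\<close>

lemma affine_ode_solution:
  fixes c :: "real \<Rightarrow> real^'n"
  assumes c: "\<And>t. (c has_vector_derivative B *v c t + d) (at t)"
  shows "c t = mat_exp (t *\<^sub>R B) *v c 0 + F_mat B t *v d"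
proof -
  define x where "x = (\<lambda>t. c t - F_mat B t *v d)"
  have "(x has_vector_derivative B *v x t) (at t)" for t
    unfolding x_def
    by (rule derivative_eq_intros c F_mat_mult_vec_has_vector_derivative)+
      (simp add: matrix_vector_mult_diff_distrib)
  then have "mat_exp (- t *\<^sub>R B) *v x t = c 0"
    using mat_exp_minus_mult_ode[of x B t] by (simp add: x_def)
  \<comment> \<open>Writing t as - (- t) lets \<open>mat_exp_minus_mult\<close> at - t cancel the
    two exponentials.\<close>
  then have "mat_exp (t *\<^sub>R B) *v c 0 = (mat_exp (- (- t) *\<^sub>R B) ** mat_exp (- t *\<^sub>R B)) *v x t"
    by (simp add: matrix_vector_mul_assoc[symmetric])
  also have "\<dots> = x t"
    by (simp only: mat_exp_minus_mult matrix_vector_mul_lid)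
  finally show ?thesis by (simp add: x_def)
qed

lemma has_vector_derivative_shift_id: "((+) t has_vector_derivative (1::real)) (at s)"
  by (auto simp: has_vector_derivative_def intro!: derivative_eq_intros)

text \<open>The equation is autonomous, so the translate of \<open>c\<close> by t is again a
  solution, now with initial value \<open>c t\<close>.\<close>

lemma affine_ode_shift:
  fixes c :: "real \<Rightarrow> real^'n"
  assumes c: "\<And>t. (c has_vector_derivative B *v c t + d) (at t)"
  shows "c (t + s) = mat_exp (s *\<^sub>R B) *v c t + F_mat B s *v d"
proof -
  have "((\<lambda>s. c (t + s)) has_vector_derivative B *v c (t + s) + d) (at s)" for s
    using vector_diff_chain_at[OF has_vector_derivative_shift_id c, of t s] by (simp add: o_def)
  from affine_ode_solution[OF this, of s] show ?thesis by simp
qed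

lemma mat_exp_add: "mat_exp ((s + t) *\<^sub>R B) = mat_exp (s *\<^sub>R B) ** mat_exp (t *\<^sub>R B)"
proof -
  have "mat_exp ((t + s) *\<^sub>R B) *v v = mat_exp (s *\<^sub>R B) *v (mat_exp (t *\<^sub>R B) *v v)" for v
    using affine_ode_shift[of "\<lambda>t. mat_exp (t *\<^sub>R B) *v v" B 0 t s]
      has_vector_derivative_matrix_vector_mult
        [OF mat_exp_has_vector_derivative has_vector_derivative_const[of v]]
    by (simp add: matrix_vector_mul_assoc)
  then show ?thesis by (simp add: matrix_eq matrix_vector_mul_assoc add.commute)
qed

lemma F_mat_add_mult_vec:
  "F_mat B (s + t) *v d = mat_exp (s *\<^sub>R B) *v (F_mat B t *v d) + F_mat B s *v d"
  using affine_ode_shift[where c = "\<lambda>t. F_mat B t *v d", OF F_mat_mult_vec_has_vector_derivative, of t s]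
  by (simp add: add.commute)

text \<open>Makes linear and translation part together one curve solving a linear equation in the
  product space, so that smoothness of curves in the affine group follows.\<close>

lemma bounded_linear_matrix_mult_Pair:
  fixes B :: "real^'n^'n"
  shows "bounded_linear (\<lambda>g :: (real^'n^'n) \<times> (real^'n). (B ** fst g, B *v snd g))"
  by (intro bounded_linear_Pair bounded_linear_fst bounded_linear_snd
      bounded_bilinear.bounded_linear_right[OF bounded_bilinear_matrix_matrix_mult,
        THEN bounded_linear_compose]
      bounded_linear_compose[OF matrix_vector_mul_bounded_linear])

lemma one_parameter_subgroup_affine_flow:
  "one_parameter_subgroup (\<lambda>t. (mat_exp (t *\<^sub>R B), F_mat B t *v d))"
  unfolding one_parameter_subgroup_def
proof
  show "(\<lambda>t. (mat_exp (t *\<^sub>R B), F_mat B t *v d)) \<in> hom real_add_group aff_group"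
    by (auto simp: hom_def real_add_group_def aff_group_def invertible_mat_exp mat_exp_add
        F_mat_add_mult_vec)
  show "smooth_curve_on UNIV (\<lambda>t. (mat_exp (t *\<^sub>R B), F_mat B t *v d))"
  proof (rule smooth_curve_on_linear_ode[OF bounded_linear_matrix_mult_Pair, of _ B "(0, d)"])
    show "((\<lambda>t. (mat_exp (t *\<^sub>R B), F_mat B t *v d)) has_vector_derivative
        (B ** fst (mat_exp (t *\<^sub>R B), F_mat B t *v d), B *v snd (mat_exp (t *\<^sub>R B), F_mat B t *v d)) +
        (0, d)) (at t)" for t
      using has_vector_derivative_Pair[OF mat_exp_has_vector_derivative[of B t]
          F_mat_mult_vec_has_vector_derivative[of B d t]]
      by simp
  qed
qed

section \<open>Solitons\<close>

lemma soliton_affine_ode: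
  fixes c :: "real \<Rightarrow> real^'n"
  assumes c: "\<And>t. (c has_vector_derivative B *v c t + d) (at t)"
  shows "soliton \<alpha> c"
proof -
  define A where "A = (\<lambda>s. (1 - \<alpha>) *\<^sub>R mat 1 + \<alpha> *\<^sub>R mat_exp (s *\<^sub>R B))"
  define b where "b = (\<lambda>s. \<alpha> *\<^sub>R (F_mat B s *v d))"
  \<comment> \<open>The derivative \<alpha> B exp(sB) is rewritten in terms of \<open>A s\<close> to
    obtain the form required by \<open>smooth_curve_on_linear_ode\<close>.\<close>
  have A': "(A has_vector_derivative B ** A s - (1 - \<alpha>) *\<^sub>R B) (at s)" for s
    using has_vector_derivative_add[OF has_vector_derivative_const
        bounded_linear.has_vector_derivative[OF bounded_linear_scaleR_right
          mat_exp_has_vector_derivative], of "(1 - \<alpha>) *\<^sub>R mat 1" \<alpha> B s]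
    by (simp add: A_def matrix_add_ldistrib matrix_scalar_ac scalar_matrix_assoc[symmetric])
  have b': "(b has_vector_derivative B *v b s + \<alpha> *\<^sub>R d) (at s)" for s
    using bounded_linear.has_vector_derivative[OF bounded_linear_scaleR_right
        F_mat_mult_vec_has_vector_derivative, of \<alpha> B d s]
    by (simp add: b_def matrix_vector_mult_scaleR scaleR_add_right)
  have "continuous (at s) A" for s
    using A' by (rule has_vector_derivative_continuous)
  then have "isCont (\<lambda>s. det (A s)) 0"
    unfolding det_def by (intro continuous_intros)
  \<comment> \<open>\<open>A 0\<close> is the identity, because the weights 1 - \<alpha> and
    \<alpha> add up to 1.\<close>
  moreover have "det (A 0) \<noteq> 0"
    by (simp add: A_def scaleR_add_left[symmetric])
  ultimately have "\<forall>\<^sub>F s in at 0. det (A s) \<noteq> 0"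
    by (simp add: isCont_def tendsto_imp_eventually_ne)
  then obtain \<epsilon> where \<epsilon>: "0 < \<epsilon>" "\<And>s. s \<noteq> 0 \<Longrightarrow> \<bar>s\<bar> < \<epsilon> \<Longrightarrow> det (A s) \<noteq> 0"
    by (auto simp: eventually_at dist_real_def)
  \<comment> \<open>The filter \<open>at 0\<close> says nothing about s = 0 itself, hence the case
    distinction.\<close>
  have "invertible (A s)" if "\<bar>s\<bar> < \<epsilon>" for s
    using \<epsilon>(2)[of s] that \<open>det (A 0) \<noteq> 0\<close> by (cases "s = 0") (auto simp: invertible_det_nz)
  then have "(\<lambda>s. (A s, b s)) ` {-\<epsilon><..<\<epsilon>} \<subseteq> carrier aff_group"
    by (auto simp: aff_group_def)
  moreover have "smooth_curve_on {-\<epsilon><..<\<epsilon>} (\<lambda>s. (A s, b s))"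
    by (rule smooth_curve_on_linear_ode[OF bounded_linear_matrix_mult_Pair,
          of _ B "(- ((1 - \<alpha>) *\<^sub>R B), \<alpha> *\<^sub>R d)"])
      (use has_vector_derivative_Pair[OF A' b'] in simp)
  moreover have "(1 - \<alpha>) *\<^sub>R c t + \<alpha> *\<^sub>R c (t + s) = aff_act (A s, b s) (c t)" for s t
    by (simp add: affine_ode_shift[OF c, of t s] aff_act_def A_def b_def
        matrix_vector_mult_add_rdistrib scaleR_matrix_vector_assoc[symmetric] scaleR_add_right)
  moreover have "smooth_curve_on UNIV c"
    by (rule smooth_curve_on_linear_ode[OF matrix_vector_mul_bounded_linear c])
  ultimately show ?thesis
    unfolding soliton_def using \<epsilon>(1) by blast
qed

theorem theorem3:
  fixes \<alpha> :: real and B :: "real^'n^'n" and d :: "real^'n" and c :: "real \<Rightarrow> real^'n"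
  assumes "0 < \<alpha>" and "\<alpha> < 1"
    and "\<forall>t. (c has_vector_derivative (B *v c t + d)) (at t)"
  shows "soliton \<alpha> c \<and>
    one_parameter_subgroup (\<lambda>t. (mat_exp (t *\<^sub>R B), F_mat B t *v d)) \<and>
    range c = orbit (aff_group\<lparr>carrier := range (\<lambda>t. (mat_exp (t *\<^sub>R B), F_mat B t *v d))\<rparr>)
                aff_act (c 0) \<and>
    (\<forall>t. c t = c 0 + F_mat B t *v (B *v c 0 + d)) \<and>
    (\<forall>t. c t = mat_exp (t *\<^sub>R B) *v c 0 + F_mat B t *v d)"
proof -
  have c: "(c has_vector_derivative (B *v c t + d)) (at t)" for t
    using assms(3) by blast
  note sol = affine_ode_solution[OF c]
  have "orbit (aff_group\<lparr>carrier := range (\<lambda>t. (mat_exp (t *\<^sub>R B), F_mat B t *v d))\<rparr>)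
      aff_act (c 0) = range (\<lambda>t. aff_act (mat_exp (t *\<^sub>R B), F_mat B t *v d) (c 0))"
    by (auto simp: orbit_def)
  also have "\<dots> = range c"
    by (simp add: aff_act_def sol[symmetric])
  finally have "range c = orbit (aff_group\<lparr>carrier := range (\<lambda>t. (mat_exp (t *\<^sub>R B), F_mat B t *v d))\<rparr>)
      aff_act (c 0)" ..
  \<comment> \<open>Here FB = exp(tB) - 1, with B on the right of F, gives F(Bv) = exp(tB)v - v for
    v = c(0).\<close>
  moreover have "c t = c 0 + F_mat B t *v (B *v c 0 + d)" for t
    using sol[of t]
    by (simp add: matrix_vector_right_distrib matrix_vector_mul_assoc F_mat_mult_matrix
        matrix_vector_mult_diff_rdistrib)
  ultimately show ?thesis
    using soliton_affine_ode[OF c] one_parameter_subgroup_affine_flow sol by blast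
qed

end
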